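(* Let $m \geq 5$ be an integer. Then the helm graph $H_m$ satisfies $\mathrm{Z}(H_m) = \left\lceil \frac{m}{2} \right\rceil$ and $$\mathrm{pt}(H_m) \leq \begin{cases} 6 & \text{if } m \equiv 0 \pmod 4,\\ 4 & \text{if } m \equiv 1 \pmod 4,\\ 5 & \text{if } m \equiv 2 \pmod 4 \text{ or } m \equiv 3 \pmod 4. \end{cases}$$
   Context: The helm graph $H_m$ is the (simple, undirected) graph with vertex set $\{v_0,v_1,\dots,v_m\} \cup \{p_1,\dots,p_m\}$ whose edges are: $v_0v_i$ for $1\le i\le m$; $v_iv_{i+1}$ for $1 \le i \le m-1$; $v_1v_m$; and $v_ip_i$ for $1\le i\le m$. That is, it is the wheel with center $v_0$ and $m$ spoke vertices, with one pendant vertex attached to each spoke vertex. Zero forcing: each vertex of a graph $G$ is initially colored blue or white. Color change rule: if $u$ is blue and $v$ is the only white neighbor of $u$, then $u$ can force $v$ to become blue; blue vertices stay blue. A set $B \subseteq V(G)$ is a zero forcing set of $G$ if, starting with exactly the vertices of $B$ blue, repeated application of the rule eventually makes every vertex blue. The zero forcing number $\mathrm{Z}(G)$ is the minimum cardinality of a zero forcing set of $G$. Propagation time: for a zero forcing set $B$ let $B^{[0]} = B$ and, for $k \geq 1$, let $B^{[k]} = B^{[k-1]} \cup B^{(k)}$, where $B^{(k)}$ is the set of all white vertices that can be forced by the color change rule when $B^{[k-1]}$ is exactly the set of blue vertices (all possible forces are performed simultaneously in each time-step). Then $\mathrm{pt}(G,B)$ is the least $k$ with $B^{[k]} = V(G)$,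 and $\mathrm{pt}(G) = \min\{\mathrm{pt}(G,B) : B \text{ is a zero forcing set of } G \text{ with } |B| = \mathrm{Z}(G)\}$. *)

theory Defs
  imports Complex_Main "Graph_Theory.Pair_Digraph"
begin

text \<open>
  As in the library, a finite simple undirected graph is a \<^locale>\<open>pair_graph\<close>: the edge
  \<open>uv\<close> is represented by the two arcs \<open>(u, v)\<close> and \<open>(v, u)\<close>.
\<close>

subsection \<open>Zero forcing\<close>

text \<open>\<open>B\<close> is the set of blue vertices: \<open>u\<close> can force \<open>v\<close>.\<close>

definition can_force :: "'a pair_pre_digraph \<Rightarrow> 'a set \<Rightarrow> 'a \<Rightarrow> 'a \<Rightarrow> bool" where
  "can_force G B u v \<longleftrightarrow> u \<in> B \<and> {w \<in> pverts G. (u, w) \<in> parcs G \<and> w \<notin> B} = {v}"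

definition force_step :: "'a pair_pre_digraph \<Rightarrow> 'a set \<Rightarrow> 'a set \<Rightarrow> bool" where
  "force_step G B B' \<longleftrightarrow> (\<exists>u v. can_force G B u v \<and> B' = insert v B)"

text \<open>The rule is applied finitely often, one force at a time, in any order.\<close>

definition zero_forcing_set :: "'a pair_pre_digraph \<Rightarrow> 'a set \<Rightarrow> bool" where
  "zero_forcing_set G B \<longleftrightarrow> B \<subseteq> pverts G \<and> (force_step G)\<^sup>*\<^sup>* B (pverts G)"

text \<open>The full vertex set is a zero forcing set, so for finite \<open>G\<close> the minimum is attained.\<close>

definition zero_forcing_number :: "'a pair_pre_digraph \<Rightarrow> nat" where
  "zero_forcing_number G = (LEAST n. \<exists>B. zero_forcing_set G B \<and> card B = n)"

subsection \<open>Propagation time\<close>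

text \<open>\<open>blue_after G B k\<close> is the set written \<open>B\<^sup>[\<^sup>k\<^sup>]\<close>: all possible forces happen in each step.\<close>

primrec blue_after :: "'a pair_pre_digraph \<Rightarrow> 'a set \<Rightarrow> nat \<Rightarrow> 'a set" where
  "blue_after G B 0 = B"
| "blue_after G B (Suc k) = blue_after G B k \<union> {v. \<exists>u. can_force G (blue_after G B k) u v}"

text \<open>Meaningful only if \<open>B\<close> is a zero forcing set: otherwise no \<open>k\<close> qualifies.\<close>

definition pt_set :: "'a pair_pre_digraph \<Rightarrow> 'a set \<Rightarrow> nat" where
  "pt_set G B = (LEAST k. blue_after G B k = pverts G)"

definition propagation_time :: "'a pair_pre_digraph \<Rightarrow> nat" where
  "propagation_time G =
     (LEAST k. \<exists>B. zero_forcing_set G B \<and> card B = zero_forcing_number G \<and> pt_set G B = k)"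

subsection \<open>Helm graphs\<close>

text \<open>\<open>Wheel i\<close> is \<open>v\<^sub>i\<close> (with \<open>Wheel 0\<close> the centre) and \<open>Pendant i\<close> is \<open>p\<^sub>i\<close>.\<close>

datatype helm_vertex = Wheel nat | Pendant nat

definition helm_edges :: "nat \<Rightarrow> (helm_vertex \<times> helm_vertex) set" where
  "helm_edges m =
     {(Wheel 0, Wheel i) | i. 1 \<le> i \<and> i \<le> m}
   \<union> {(Wheel i, Wheel (i + 1)) | i. 1 \<le> i \<and> i + 1 \<le> m}
   \<union> {(Wheel 1, Wheel m)}
   \<union> {(Wheel i, Pendant i) | i. 1 \<le> i \<and> i \<le> m}"

definition helm :: "nat \<Rightarrow> helm_vertex pair_pre_digraph" where
  "helm m = \<lparr> pverts = Wheel ` {0..m} \<union> Pendant ` {1..m},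
              parcs = helm_edges m \<union> (helm_edges m)\<inverse> \<rparr>"

lemma zero_forcing_set_pverts: "zero_forcing_set G (pverts G)"
  by (simp add: zero_forcing_set_def)

lemma pair_graph_helm:
  assumes "m \<ge> 3"
  shows "pair_graph (helm m)"
proof -
  have sub: "parcs (helm m) \<subseteq> pverts (helm m) \<times> pverts (helm m)"
    using assms by (auto simp: helm_def helm_edges_def)
  have fin: "finite (pverts (helm m))"
    by (simp add: helm_def)
  show ?thesis
  proof
    show "finite (parcs (helm m))"
      using sub fin by (meson finite_SigmaI finite_subset)
    show "symmetric (with_proj (helm m))"
      by (auto simp: symmetric_def arcs_ends_def arc_to_ends_def helm_def sym_def)
    show "fst e \<noteq> snd e" if "e \<in> parcs (helm m)" for e
      using that assms by (auto simp: helm_def helm_edges_def)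
  qed (use sub fin in auto)
qed

end

theory Submission
  imports Defs
begin

text \<open>
  Lower bound: call a blue vertex active if it has a white neighbour. A force deactivates the
  forcing vertex and can only activate the forced one, and a forced leaf never becomes active.
  Hence the number of active vertices plus the number of forced leaves never exceeds \<open>card B\<close>, so
  at most \<open>card B\<close> leaves are outside \<open>B\<close>, and at most \<open>card B\<close> are inside.

  Upper bound: colour the pendants \<open>p\<^sub>1, p\<^sub>2, p\<^sub>3, p\<^sub>6, p\<^sub>7, p\<^sub>1\<^sub>0, p\<^sub>1\<^sub>1, \<dots>\<close> blue, with a correction at
  the end of the cycle. Their wheel neighbours are blue after one step, and \<open>v\<^sub>2\<close> then forces the
  centre. In the third step the neighbours of the blocks of blue rim vertices are forced; at most two
  rim vertices stay white, the last of which is forced by the centre. Once the rim is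
  blue, the remaining pendants need one more step.
\<close>

section \<open>Zero forcing in general graphs\<close>

lemma can_force_in_pverts: "can_force G S u v \<Longrightarrow> v \<in> pverts G"
  unfolding can_force_def by blast

lemma blue_after_subset: "B \<subseteq> pverts G \<Longrightarrow> blue_after G B k \<subseteq> pverts G"
  by (induction k) (auto dest: can_force_in_pverts)

lemma blue_after_mono: "j \<le> k \<Longrightarrow> blue_after G B j \<subseteq> blue_after G B k"
  by (rule lift_Suc_mono_le) auto

text \<open>Callers need not know that \<open>v\<close> is white: a vertex already blue stays
  blue.\<close>

lemma blue_after_SucI:
  assumes "u \<in> blue_after G B k" "(u, v) \<in> parcs G" "v \<in> pverts G"
    and "\<And>w. (u, w) \<in> parcs G \<Longrightarrow> w = v \<or> w \<in> blue_after G B k"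
  shows "v \<in> blue_after G B (Suc k)"
proof (cases "v \<in> blue_after G B k")
  case False
  then have "can_force G (blue_after G B k) u v"
    using assms unfolding can_force_def by blast
  then show ?thesis by auto
qed simp

text \<open>Simultaneous forces can be carried out one at a time: extra blue vertices only shrink
  the set of white neighbours of \<open>u\<close>, so \<open>u\<close> can still force
  \<open>v\<close> unless \<open>v\<close> is already blue.\<close>

lemma rtranclp_force_step_Un:
  assumes "finite F" "\<And>v. v \<in> F \<Longrightarrow> \<exists>u. can_force G S u v"
  shows "(force_step G)\<^sup>*\<^sup>* S (S \<union> F)"
  using assms
proof (induction F rule: finite_induct)
  case (insert v F)
  then have reach: "(force_step G)\<^sup>*\<^sup>* S (S \<union> F)" by simp
  show ?case
  proof (cases "v \<in> S \<union> F")
    case True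
    then show ?thesis using reach by (simp add: insert_absorb)
  next
    case False
    obtain u where "can_force G S u v" using insert.prems by blast
    with False have "can_force G (S \<union> F) u v" unfolding can_force_def by blast
    then have "force_step G (S \<union> F) (S \<union> insert v F)" unfolding force_step_def by auto
    with reach show ?thesis by (rule rtranclp.rtrancl_into_rtrancl)
  qed
qed simp

lemma rtranclp_force_step_blue_after:
  assumes "finite (pverts G)"
  shows "(force_step G)\<^sup>*\<^sup>* B (blue_after G B k)"
proof (induction k)
  case (Suc k)
  let ?F = "{v. \<exists>u. can_force G (blue_after G B k) u v}"
  have "finite ?F"
    using assms by (rule finite_subset[rotated]) (auto dest: can_force_in_pverts)
  then have "(force_step G)\<^sup>*\<^sup>* (blue_after G B k) (blue_after G B k \<union> ?F)"
    by (rule rtranclp_force_step_Un) simp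
  then show ?case using Suc.IH by simp
qed simp

lemma zero_forcing_set_if_blue_after:
  assumes "finite (pverts G)" "B \<subseteq> pverts G" "pverts G \<subseteq> blue_after G B k"
  shows "zero_forcing_set G B"
  using rtranclp_force_step_blue_after[OF assms(1), of B k] blue_after_subset[OF assms(2)] assms
  unfolding zero_forcing_set_def by (metis subset_antisym)

text \<open>\<open>k\<close> may exceed the exact time of \<open>B\<close>: it bounds
  \<open>pt_set G B\<close>, one of the values that \<open>propagation_time\<close> minimises
  over.\<close>

lemma propagation_time_le:
  assumes "finite (pverts G)" "B \<subseteq> pverts G" "card B = zero_forcing_number G"
    and "pverts G \<subseteq> blue_after G B k"
  shows "propagation_time G \<le> k"
proof -
  have "blue_after G B k = pverts G"
    using blue_after_subset[OF assms(2)] assms(4) by blast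
  then have "pt_set G B \<le> k" unfolding pt_set_def by (rule Least_le)
  moreover have "propagation_time G \<le> pt_set G B"
    unfolding propagation_time_def
    using zero_forcing_set_if_blue_after[OF assms(1,2,4)] assms(3) by (blast intro: Least_le)
  ultimately show ?thesis by simp
qed

section \<open>Active vertices and the number of forced leaves\<close>

definition active :: "'a pair_pre_digraph \<Rightarrow> 'a set \<Rightarrow> 'a set" where
  "active G S = {u \<in> S. \<exists>w \<in> pverts G. (u, w) \<in> parcs G \<and> w \<notin> S}"

lemma active_insert:
  assumes "can_force G S u v"
  shows "active G (insert v S) \<subseteq> insert v (active G S - {u})" "u \<in> active G S"
  using assms unfolding active_def can_force_def by blast+

lemma card_active_forced_leaves:
  assumes fin: "finite (pverts G)" and sym: "sym (parcs G)" and B: "B \<subseteq> pverts G"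
    and leaf: "\<And>x y z. x \<in> L \<Longrightarrow> (x, y) \<in> parcs G \<Longrightarrow> (x, z) \<in> parcs G \<Longrightarrow> y = z"
    and reach: "(force_step G)\<^sup>*\<^sup>* B S"
  shows "S \<subseteq> pverts G \<and> card (active G S) + card (L \<inter> S - B) \<le> card B"
  using reach
proof (induction rule: rtranclp_induct)
  case base
  have "card (active G B) \<le> card B"
    using finite_subset[OF B fin] by (intro card_mono) (auto simp: active_def)
  then show ?case using B by (simp add: Diff_eq Int_assoc)
next
  case (step S S')
  then obtain u v where uv: "can_force G S u v" and S': "S' = insert v S"
    unfolding force_step_def by blast
  have fS: "finite S" using step.IH fin finite_subset by blast
  have fA: "finite (active G S)"
    using fS by (rule finite_subset[rotated]) (auto simp: active_def)
  have card_A: "card (active G S) = Suc (card (active G S - {u}))"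
    using active_insert(2)[OF uv] fA by (metis card_Suc_Diff1)
  have "card (active G S') + card (L \<inter> S' - B) \<le> card (active G S) + card (L \<inter> S - B)"
  proof (cases "v \<in> L")
    case True
    \<comment> \<open>By symmetry \<open>u\<close> is the only neighbour of the leaf
      \<open>v\<close>, and it is blue. So \<open>v\<close> is inactive, and the loss of
      \<open>u\<close> from the active set pays for the new forced leaf.\<close>
    have "(v, u) \<in> parcs G" using uv sym unfolding can_force_def by (blast dest: symD)
    then have "v \<notin> active G S'"
      using leaf[OF True] uv unfolding S' active_def can_force_def by blast
    then have "card (active G S') \<le> card (active G S - {u})"
      using active_insert(1)[OF uv] fA unfolding S' by (intro card_mono) auto
    moreover have "card (L \<inter> S' - B) \<le> card (insert v (L \<inter> S - B))"
      using fS unfolding S' by (intro card_mono) auto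
    moreover have "\<dots> \<le> Suc (card (L \<inter> S - B))" by (rule card_insert_le_m1) auto
    ultimately show ?thesis using card_A by simp
  next
    case False
    \<comment> \<open>A vertex outside \<open>L\<close> may become active, but then it only takes
      the place of \<open>u\<close>.\<close>
    have "card (active G S') \<le> card (insert v (active G S - {u}))"
      using active_insert(1)[OF uv] fA unfolding S' by (intro card_mono) auto
    also have "\<dots> \<le> card (active G S)" using fA card_A by (simp add: card_insert_if)
    finally show ?thesis using False unfolding S' by simp
  qed
  then show ?case using step.IH uv S' by (auto dest: can_force_in_pverts)
qed

lemma card_leaves_le_zero_forcing:
  assumes "finite (pverts G)" "sym (parcs G)" "L \<subseteq> pverts G" "zero_forcing_set G B"
    and "\<And>x y z. x \<in> L \<Longrightarrow> (x, y) \<in> parcs G \<Longrightarrow> (x, z) \<in> parcs G \<Longrightarrow> y = z"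
  shows "card L \<le> 2 * card B"
proof -
  have B: "B \<subseteq> pverts G" "(force_step G)\<^sup>*\<^sup>* B (pverts G)"
    using assms(4) unfolding zero_forcing_set_def by auto
  have fB: "finite B" using B(1) assms(1) finite_subset by blast
  have "card (L \<inter> pverts G - B) \<le> card B"
    using card_active_forced_leaves[OF assms(1,2) B(1) _ B(2), of L] assms(5) by force
  moreover have "L \<inter> pverts G = L" using assms(3) by blast
  moreover have "card L \<le> card (L - B) + card B"
    by (metis add.commute card_Un_le card_mono fB finite_Diff2 Un_Diff_cancel Un_upper2
        card.infinite finite_Un le0 le_trans)
  ultimately show ?thesis by simp
qed

section \<open>Helm graphs\<close>

declare blue_after.simps(2) [simp del]

lemma finite_pverts_helm: "finite (pverts (helm m))"
  by (simp add: helm_def)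

lemma sym_parcs_helm: "sym (parcs (helm m))"
  by (auto simp: helm_def sym_def)

lemma pverts_helm [simp]:
  "Wheel i \<in> pverts (helm m) \<longleftrightarrow> i \<le> m"
  "Pendant i \<in> pverts (helm m) \<longleftrightarrow> 1 \<le> i \<and> i \<le> m"
  by (auto simp: helm_def)

lemma parcs_helm_Pendant:
  "(Pendant i, w) \<in> parcs (helm m) \<longleftrightarrow> 1 \<le> i \<and> i \<le> m \<and> w = Wheel i"
  by (auto simp: helm_def helm_edges_def)

lemma parcs_helm_centre:
  assumes "1 \<le> m"
  shows "(Wheel 0, w) \<in> parcs (helm m) \<longleftrightarrow> w \<in> Wheel ` {1..m}"
  using assms by (auto simp: helm_def helm_edges_def)

text \<open>The conditionals close the cycle on the indices \<open>1..m\<close>; index 0 is taken by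
  the centre.\<close>

definition rim_nbrs :: "nat \<Rightarrow> nat \<Rightarrow> helm_vertex set" where
  [simp]: "rim_nbrs m i =
    {Wheel 0, Pendant i, Wheel (if i = m then 1 else i + 1), Wheel (if i = 1 then m else i - 1)}"

lemma parcs_helm_rim:
  assumes "3 \<le> m" "1 \<le> i" "i \<le> m"
  shows "(Wheel i, w) \<in> parcs (helm m) \<longleftrightarrow> w \<in> rim_nbrs m i"
proof -
  have "(\<exists>j. i = j + 1 \<and> w = Wheel j \<and> 1 \<le> j) \<longleftrightarrow> i \<noteq> 1 \<and> w = Wheel (i - 1)"
    using assms by (cases i) auto
  then show ?thesis
    using assms by (auto simp: helm_def helm_edges_def)
qed

lemma zero_forcing_set_helm_card:
  assumes "zero_forcing_set (helm m) B"
  shows "(m + 1) div 2 \<le> card B"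
proof -
  have "card (Pendant ` {1..m}) \<le> 2 * card B"
    using finite_pverts_helm sym_parcs_helm _ assms
    by (rule card_leaves_le_zero_forcing) (auto simp: parcs_helm_Pendant)
  moreover have "card (Pendant ` {1..m}) = m"
    by (subst card_image) (auto simp: inj_on_def)
  ultimately show ?thesis by simp
qed

lemma Wheel_SucI:
  assumes "Pendant i \<in> blue_after (helm m) B k" "1 \<le> i" "i \<le> m"
  shows "Wheel i \<in> blue_after (helm m) B (Suc k)"
  using assms by (intro blue_after_SucI[of "Pendant i"]) (auto simp: parcs_helm_Pendant)

text \<open>\<open>v\<close> is arbitrary so that one rule covers forcing the centre, the pendant
  and either neighbour on the rim.\<close>

lemma rim_force:
  assumes "3 \<le> m" "1 \<le> i" "i \<le> m" "Wheel i \<in> blue_after (helm m) B k"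
    and "v \<in> rim_nbrs m i" "rim_nbrs m i - {v} \<subseteq> blue_after (helm m) B k"
  shows "v \<in> blue_after (helm m) B (Suc k)"
proof (rule blue_after_SucI)
  show "Wheel i \<in> blue_after (helm m) B k" by fact
  show "(Wheel i, v) \<in> parcs (helm m)"
    using parcs_helm_rim[OF assms(1-3)] assms(5) by blast
  show "v \<in> pverts (helm m)" using assms(1-3,5) by (auto split: if_splits)
  show "w = v \<or> w \<in> blue_after (helm m) B k" if "(Wheel i, w) \<in> parcs (helm m)" for w
    using that parcs_helm_rim[OF assms(1-3)] assms(6) by blast
qed

lemma centre_force:
  assumes "j \<in> {1..m}" and "\<And>i. i \<le> m \<Longrightarrow> i \<noteq> j \<Longrightarrow> Wheel i \<in> blue_after (helm m) B k"
  shows "Wheel j \<in> blue_after (helm m) B (Suc k)"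
proof (rule blue_after_SucI)
  have m: "1 \<le> m" using assms(1) by simp
  \<comment> \<open>The centre is the instance \<open>i = 0\<close> of the hypothesis, since
    \<open>j \<ge> 1\<close>.\<close>
  show "Wheel 0 \<in> blue_after (helm m) B k" using assms by simp
  show "(Wheel 0, Wheel j) \<in> parcs (helm m)" "Wheel j \<in> pverts (helm m)"
    using assms(1) m by (simp_all add: parcs_helm_centre)
  show "w = Wheel j \<or> w \<in> blue_after (helm m) B k" if "(Wheel 0, w) \<in> parcs (helm m)" for w
    using that assms(2) unfolding parcs_helm_centre[OF m] by fastforce
qed

lemma helm_blue_if_wheel_blue:
  assumes "3 \<le> m" and wheel: "\<And>i. i \<le> m \<Longrightarrow> Wheel i \<in> blue_after (helm m) B k"
  shows "pverts (helm m) \<subseteq> blue_after (helm m) B (Suc k)"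
proof
  fix x assume x: "x \<in> pverts (helm m)"
  show "x \<in> blue_after (helm m) B (Suc k)"
  proof (cases x)
    case (Wheel i)
    then show ?thesis using wheel x by (auto simp: blue_after.simps(2))
  next
    case (Pendant i)
    then have "1 \<le> i" "i \<le> m" using x by auto
    then show ?thesis
      using \<open>3 \<le> m\<close> wheel unfolding Pendant by (intro rim_force[of m i]) auto
  qed
qed

text \<open>One step for the centre to force \<open>Wheel j\<close>, a second one for the
  pendants.\<close>

lemma helm_blue_if_wheel_blue_but_one:
  assumes "3 \<le> m" "j \<in> {1..m}"
    and "\<And>i. i \<le> m \<Longrightarrow> i \<noteq> j \<Longrightarrow> Wheel i \<in> blue_after (helm m) B k"
  shows "pverts (helm m) \<subseteq> blue_after (helm m) B (Suc (Suc k))"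
proof (rule helm_blue_if_wheel_blue[OF assms(1)])
  show "Wheel i \<in> blue_after (helm m) B (Suc k)" if "i \<le> m" for i
    using centre_force[OF assms(2,3)] assms(3)[OF that]
    by (cases "i = j") (auto simp: blue_after.simps(2))
qed

section \<open>A small zero forcing set\<close>

text \<open>Between consecutive pairs \<open>4 * q + 2\<close>, \<open>4 * q + 3\<close> lie two
  indices, each next to a pair. The index \<open>m\<close> is never a seed. If
  \<open>4 dvd m\<close>, the full pattern has one index too many, and \<open>m - 2\<close> is
  dropped.\<close>

definition seeds :: "nat \<Rightarrow> nat set" where
  "seeds m = insert 1
    ({4 * q + 2 | q. 4 * q + 2 < m \<and> m \<noteq> 4 * q + 4} \<union> {4 * q + 3 | q. 4 * q + 3 < m})"

lemma seedsI:
  "1 \<in> seeds m"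
  "4 * q + 2 < m \<Longrightarrow> m \<noteq> 4 * q + 4 \<Longrightarrow> 4 * q + 2 \<in> seeds m"
  "4 * q + 3 < m \<Longrightarrow> 4 * q + 3 \<in> seeds m"
  unfolding seeds_def by blast+

lemma seeds_cases:
  assumes "i \<in> seeds m"
  obtains "i = 1"
    | q where "i = 4 * q + 2" "4 * q + 2 < m" "m \<noteq> 4 * q + 4"
    | q where "i = 4 * q + 3" "4 * q + 3 < m"
  using assms unfolding seeds_def by blast

lemma nat_mod_4_cases:
  fixes i :: nat
  obtains q where "i = 4 * q" | q where "i = 4 * q + 1" | q where "i = 4 * q + 2"
    | q where "i = 4 * q + 3"
proof -
  have "\<exists>q. i = 4 * q \<or> i = 4 * q + 1 \<or> i = 4 * q + 2 \<or> i = 4 * q + 3"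
    by presburger
  then show thesis using that by blast
qed

lemma card_seeds:
  assumes m: "m \<ge> 5"
  shows "card (Pendant ` seeds m) \<le> (m + 1) div 2"
proof -
  \<comment> \<open>\<open>?g\<close> lists the seeds in increasing order: 1 at position 0,
    \<open>4 * q + 2\<close> at \<open>2 * q + 1\<close> and \<open>4 * q + 3\<close> at
    \<open>2 * q + 2\<close>. If \<open>4 dvd m\<close>, the last position would hold the dropped
    \<open>m - 2\<close> and receives \<open>m - 1\<close> instead. Surjectivity suffices for an
    upper bound.\<close>
  let ?g = "\<lambda>j. if j = 0 then 1 else if 4 dvd m \<and> j + 1 = m div 2 then m - 1
    else if odd j then 2 * j else 2 * j - 1"
  have "seeds m \<subseteq> ?g ` {..<(m + 1) div 2}"
  proof
    fix i assume "i \<in> seeds m"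
    then show "i \<in> ?g ` {..<(m + 1) div 2}"
    proof (cases rule: seeds_cases)
      case 1
      then show ?thesis using m by (intro image_eqI[of _ _ 0]) auto
    next
      case (2 q)
      have "2 * q + 1 < (m + 1) div 2" using 2(2) by linarith
      moreover have "\<not> (4 dvd m \<and> 2 * q + 1 + 1 = m div 2)" using 2(3) by (auto elim!: dvdE)
      ultimately show ?thesis using 2(1) by (intro image_eqI[of _ _ "2 * q + 1"]) auto
    next
      case (3 q)
      show ?thesis
      proof (cases "m = 4 * q + 4")
        case True
        then have "4 dvd m \<and> 2 * q + 1 + 1 = m div 2" by simp
        then show ?thesis using 3(1) True by (intro image_eqI[of _ _ "2 * q + 1"]) auto
      next
        case False
        then have "2 * q + 2 < (m + 1) div 2" using 3(2) by linarith
        moreover have "\<not> (4 dvd m \<and> 2 * q + 2 + 1 = m div 2)" by presburger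
        ultimately show ?thesis using 3(1) by (intro image_eqI[of _ _ "2 * q + 2"]) auto
      qed
    qed
  qed
  then have "card (seeds m) \<le> card {..<(m + 1) div 2}"
    by (rule surj_card_le[rotated]) simp
  then show ?thesis
    by (subst card_image) (auto simp: inj_on_def)
qed

section \<open>Propagation from the seeded pendants\<close>

context
  fixes m :: nat
  assumes m: "m \<ge> 5"
begin

abbreviation (input) blue :: "nat \<Rightarrow> helm_vertex set" where
  "blue \<equiv> blue_after (helm m) (Pendant ` seeds m)"

lemma seeds_bounds: "i \<in> seeds m \<Longrightarrow> 1 \<le> i \<and> i < m"
  using m by (auto elim: seeds_cases)

text \<open>\<open>m \<ge> 5\<close> rules out \<open>m = 4\<close>, where the correction would drop
  2. Three consecutive seeds let \<open>Wheel 2\<close> force the centre.\<close>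

lemma seeds_123: "1 \<in> seeds m" "2 \<in> seeds m" "3 \<in> seeds m"
  using m seedsI(1)[of m] seedsI(2)[of 0 m] seedsI(3)[of 0 m] by (auto simp: numeral_2_eq_2)

lemma Pendant_seeds_blue: "i \<in> seeds m \<Longrightarrow> Pendant i \<in> blue k"
  using blue_after_mono[of 0 k "helm m" "Pendant ` seeds m"] by auto

lemma Wheel_seeds_blue:
  assumes "i \<in> seeds m" "1 \<le> k"
  shows "Wheel i \<in> blue k"
  using Wheel_SucI[OF Pendant_seeds_blue[OF assms(1)], of 0] seeds_bounds[OF assms(1)]
    blue_after_mono[OF assms(2)] by fastforce

lemma centre_blue:
  assumes "2 \<le> k"
  shows "Wheel 0 \<in> blue k"
proof -
  have "Wheel 0 \<in> blue (Suc 1)"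
    by (rule rim_force[of _ 2])
       (use m seeds_123 Pendant_seeds_blue[of 2] Wheel_seeds_blue[of _ 1] in
         \<open>auto simp: numeral_3_eq_3\<close>)
  moreover have "blue (Suc 1) \<subseteq> blue k" using assms by (intro blue_after_mono) simp
  ultimately show ?thesis by blast
qed

text \<open>From time 2 on, the centre is blue, so a seed with one blue rim neighbour forces the
  other. Seeds lie below \<open>m\<close>, so only the predecessor can wrap around.\<close>

lemma rim_forward:
  assumes "i \<in> seeds m" "Wheel (if i = 1 then m else i - 1) \<in> blue k" "2 \<le> k"
  shows "Wheel (i + 1) \<in> blue (Suc k)"
  by (rule rim_force[of _ i])
     (use assms m seeds_bounds[of i] Pendant_seeds_blue Wheel_seeds_blue centre_blue in auto)

lemma rim_backward:
  assumes "i \<in> seeds m" "Wheel (i + 1) \<in> blue k" "2 \<le> k"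
  shows "Wheel (if i = 1 then m else i - 1) \<in> blue (Suc k)"
  by (rule rim_force[of _ i])
     (use assms m seeds_bounds[of i] Pendant_seeds_blue Wheel_seeds_blue centre_blue in auto)

text \<open>A seed next to another seed already has that neighbour blue at time 2, hence forces the
  vertex on its other side at time 3.\<close>

lemma rim_blue_3:
  assumes "i \<le> m" "i = 0 \<or> i = m \<or> i \<in> seeds m \<or> 3 \<le> i \<and> {i - 1, i - 2} \<subseteq> seeds m
    \<or> {i + 1, i + 2} \<subseteq> seeds m"
  shows "Wheel i \<in> blue 3"
proof -
  consider "i = 0" | "i = m" | "i \<in> seeds m" | "3 \<le> i" "{i - 1, i - 2} \<subseteq> seeds m"
    | "1 \<le> i" "{i + 1, i + 2} \<subseteq> seeds m"
    using assms(2) by (cases "i = 0") auto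
  then have "Wheel i \<in> blue (Suc 2)"
  proof cases
    case 1
    then show ?thesis by (simp only:) (rule centre_blue, simp)
  next
    case 2
    \<comment> \<open>\<open>m\<close> is the cyclic predecessor of seed 1, whose successor 2 is a
      seed as well.\<close>
    then show ?thesis
      using rim_backward[of 1 2] seeds_123 Wheel_seeds_blue[of 2 2] by (auto simp: numeral_2_eq_2)
  next
    case 3
    then show ?thesis by (rule Wheel_seeds_blue) simp
  next
    case 4
    then have "i = i - 2 + 2" by simp
    then obtain j where i: "i = j + 2" by blast
    show ?thesis
      using 4 rim_forward[of "j + 1" 2] Wheel_seeds_blue[of j 2] unfolding i by simp
  next
    case 5
    then show ?thesis
      using rim_backward[of "i + 1" 2] Wheel_seeds_blue[of "i + 2" 2]
      by simp
  qed
  then show ?thesis by simp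
qed

text \<open>The excluded indices are the \<open>4 * q + 1 < m\<close> not followed by a complete
  pair of seeds, and the dropped seed \<open>m - 2\<close> when \<open>4 dvd m\<close>.\<close>

lemma rim_blue_3_cases:
  assumes "i \<le> m"
    and "m mod 4 = 0 \<Longrightarrow> i + 3 \<noteq> m \<and> i + 2 \<noteq> m"
    and "m mod 4 = 2 \<Longrightarrow> i + 1 \<noteq> m"
    and "m mod 4 = 3 \<Longrightarrow> i + 2 \<noteq> m"
  shows "Wheel i \<in> blue 3"
proof (rule rim_blue_3[OF assms(1)])
  show "i = 0 \<or> i = m \<or> i \<in> seeds m \<or> 3 \<le> i \<and> {i - 1, i - 2} \<subseteq> seeds m
    \<or> {i + 1, i + 2} \<subseteq> seeds m"
  proof (cases i rule: nat_mod_4_cases)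
    case (1 q)
    show ?thesis
    proof (cases q)
      case (Suc p)
      then have "i = 4 * p + 4" using 1 by simp
      then have "i - 1 = 4 * p + 3" "i - 2 = 4 * p + 2" "3 \<le> i" by simp_all
      moreover have "{4 * p + 3, 4 * p + 2} \<subseteq> seeds m" if "i \<noteq> m"
        using that assms(1) \<open>i = 4 * p + 4\<close> by (simp add: seedsI del: add_2_eq_Suc')
      ultimately show ?thesis by metis
    qed (use 1 in simp)
  next
    case (2 q)
    \<comment> \<open>With \<open>i \<le> m\<close> this leaves \<open>m = i\<close> or
      \<open>m > 4 * q + 4\<close>; in the latter case the pair after \<open>i\<close> is
      complete.\<close>
    have "m \<noteq> 4 * q + 2" "m \<noteq> 4 * q + 3" using assms(3,4) 2 by (auto simp del: add_2_eq_Suc')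
    moreover have "m \<noteq> 4 * q + 4" using assms(2) 2 by auto
    ultimately have "{4 * q + 2, 4 * q + 3} \<subseteq> seeds m" if "i \<noteq> m"
      using that assms(1) 2 by (simp add: seedsI del: add_2_eq_Suc')
    moreover have "i + 1 = 4 * q + 2" "i + 2 = 4 * q + 3" using 2 by simp_all
    ultimately show ?thesis by metis
  next
    case (3 q)
    have "m \<noteq> 4 * q + 4" using assms(2) 3 by auto
    then show ?thesis using assms(1) 3 seedsI(2)[of q m] by fastforce
  next
    case (4 q)
    then show ?thesis using assms(1) seedsI(3)[of q m] by fastforce
  qed
qed

lemma helm_blue:
  "pverts (helm m) \<subseteq> blue (if m mod 4 = 0 then 6 else if m mod 4 = 1 then 4 else 5)"
proof -
  consider "m mod 4 = 0" | "m mod 4 = 1" | "m mod 4 = 2" | "m mod 4 = 3"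
    by (cases m rule: nat_mod_4_cases) (auto simp del: add_2_eq_Suc')
  then show ?thesis
  proof cases
    case 1
    obtain q where q: "m = 4 * q + 4" "q \<ge> 1"
      using 1 m by (cases m rule: nat_mod_4_cases; cases "m div 4") auto
    have m1: "m - 1 = 4 * q + 3" using q by simp
    \<comment> \<open>Of the two exceptions, \<open>m - 2\<close> is forced at time 4 by the seed
      \<open>m - 1\<close>, because \<open>m\<close> is blue at time 3. Then only
      \<open>m - 3\<close> is left for the centre.\<close>
    have "m - 1 \<in> seeds m" unfolding m1 by (rule seedsI) (simp add: q)
    moreover have "Wheel (m - 1 + 1) \<in> blue 3" using rim_blue_3_cases[of m] 1 m by simp
    ultimately have "Wheel (if m - 1 = 1 then m else m - 1 - 1) \<in> blue (Suc 3)"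
      by (rule rim_backward) simp
    then have m2: "Wheel (m - 2) \<in> blue 4" using m
      by (auto simp: numeral_2_eq_2 split: if_splits)
    have "pverts (helm m) \<subseteq> blue (Suc (Suc 4))"
    proof (rule helm_blue_if_wheel_blue_but_one)
      fix i assume i: "i \<le> m" "i \<noteq> m - 3"
      show "Wheel i \<in> blue 4"
      proof (cases "i = m - 2")
        case False
        then have "Wheel i \<in> blue 3" using i 1 m by (intro rim_blue_3_cases) auto
        then show ?thesis using blue_after_mono[of 3 4 "helm m"] by fastforce
      qed (simp add: m2)
    qed (use q in auto)
    then show ?thesis using 1 by simp
  next
    case 2
    \<comment> \<open>This residue has no exceptions, so the whole rim is blue at time 3.\<close>
    have "pverts (helm m) \<subseteq> blue (Suc 3)"
      using m 2 by (intro helm_blue_if_wheel_blue rim_blue_3_cases) auto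
    then show ?thesis using 2 by simp
  next
    case 3
    have "pverts (helm m) \<subseteq> blue (Suc (Suc 3))"
      using m 3 by (intro helm_blue_if_wheel_blue_but_one[of _ "m - 1"] rim_blue_3_cases) auto
    then show ?thesis using 3 by simp
  next
    case 4
    have "pverts (helm m) \<subseteq> blue (Suc (Suc 3))"
      using m 4 by (intro helm_blue_if_wheel_blue_but_one[of _ "m - 2"] rim_blue_3_cases) auto
    then show ?thesis using 4 by simp
  qed
qed

end

theorem theorem3p5:
  fixes m :: nat
  assumes "m \<ge> 5"
  shows "int (zero_forcing_number (helm m)) = \<lceil>real m / 2\<rceil> \<and>
         propagation_time (helm m) \<le>
           (if m mod 4 = 0 then 6 else if m mod 4 = 1 then 4 else 5)"
proof -
  let ?B = "Pendant ` seeds m"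
  have B: "?B \<subseteq> pverts (helm m)" using seeds_bounds[OF assms] by fastforce
  have zf: "zero_forcing_set (helm m) ?B"
    by (rule zero_forcing_set_if_blue_after[OF finite_pverts_helm B helm_blue[OF assms]])
  \<comment> \<open>The seeds were only counted from above; the reverse inequality is the lower
    bound applied to \<open>?B\<close> itself.\<close>
  have card_B: "card ?B = (m + 1) div 2"
    using card_seeds[OF assms] zero_forcing_set_helm_card[OF zf] by simp
  have Z: "zero_forcing_number (helm m) = (m + 1) div 2"
    unfolding zero_forcing_number_def
    using zf card_B zero_forcing_set_helm_card by (intro Least_equality) auto
  have "propagation_time (helm m) \<le> (if m mod 4 = 0 then 6 else if m mod 4 = 1 then 4 else 5)"
    by (rule propagation_time_le[OF finite_pverts_helm B _ helm_blue[OF assms]])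
       (simp add: card_B Z)
  moreover have "\<lceil>real m / 2\<rceil> = int ((m + 1) div 2)"
    by (cases "even m") (auto elim!: evenE oddE simp: ceiling_eq_iff)
  ultimately show ?thesis using Z by simp
qed

end
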